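(* Let $N\ge 2$ be an integer and let $X$ be a $(1,N)$-tangle. Then the singly generated group $G_X$ is isomorphic to the Thompson group $F_N$, where $F_N=\langle x_1,x_2,\dots \mid x_k^{-1}x_nx_k=x_{n+N-1}\ \text{for all } 1\le k<n\rangle$.
   Context: Here $\mathbb{N}=\{0,1,2,\dots\}$. A $(1,N)$-tangle $X$ is a planar box labelled $X$ with one string at the top and $N$ strings at the bottom; diagrams built from copies of $X$ are considered up to planar isotopy only. For $k\in\mathbb{N}$, the $k$-shift $X_k$ is the diagram consisting of $k$ vertical through strings on the left, then the box $X$, then infinitely many vertical through strings on the right. The product $A\cdot B$ is vertical stacking with $A$ on top and $B$ attached below. $\mathrm{Alg}(X)$ is the set of all finite products (including the empty product) of the $X_k$, $k\in\mathbb{N}$, up to planar isotopy. Explicitly, its elements are the sequences $(T_0,T_1,\dots)$ of finite planar rooted $N$-ary trees (every internal vertex has exactly $N$ ordered children), all but finitely many of which are the trivial tree (a single string). $X_k$ is the forest with $T_k$ the tree with a single internal vertex and all other $T_i$ trivial. If the leaves of $A$ are numbered $0,1,2,\dots$ from left to right, then $A\cdot B$ is obtained by grafting the $j$-th tree of $B$ onto the $j$-th leaf of $A$ for all $j$. $\mathrm{Alg}(X)_n$ is the set of $(1,n)$-tangles in $\mathrm{Alg}(X)$, i.e. the forests with $T_i$ trivial for all $i\ge 1$ and $T_0$ having exactly $n$ leaves. Let $\widehat{G_X}=\{(T_+,T_-): T_+,T_-\in \mathrm{Alg}(X)_n \text{ for some } n\in\mathbb{N}\}$. Let $\sim$ be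 the equivalence relation on $\widehat{G_X}$ generated by declaring $(T_+,T_-)$ and $(S_+,S_-)$ related if there is $R\in \mathrm{Alg}(X)$ with $T_\pm=S_\pm\cdot R$ or $S_\pm=T_\pm\cdot R$. The group $G_X$ is the set $\widehat{G_X}/\!\sim$ with the operation $\circ$ defined as follows: for $g,h\in G_X$ there are representatives $g=[(T,S)]$, $h=[(S,R)]$, and $g\circ h=[(T,R)]$. *)

theory Defs
  imports "HOL-Algebra.Group"
begin

section \<open>Diagrams built from one box\<close>

text \<open>
  Up to planar isotopy, a connected diagram with one top string that is built from boxes with one
  top string is either a single string or a box, given by its label and, from left to right, the
  diagrams attached to its bottom strings.
\<close>

datatype 'x tree = String | Box 'x "'x tree list"

fun leaves :: "'x tree \<Rightarrow> nat" where
  "leaves String = 1"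
| "leaves (Box x ts) = sum_list (map leaves ts)"

text \<open>
  \<open>graft t B\<close> attaches the tree \<open>B j\<close> to the \<open>j\<close>-th leaf of \<open>t\<close>, counted from \<open>0\<close> and from
  left to right.
\<close>

fun graft :: "'x tree \<Rightarrow> (nat \<Rightarrow> 'x tree) \<Rightarrow> 'x tree"
  and graft_list :: "'x tree list \<Rightarrow> (nat \<Rightarrow> 'x tree) \<Rightarrow> 'x tree list" where
  "graft String B = B 0"
| "graft (Box x ts) B = Box x (graft_list ts B)"
| "graft_list [] B = []"
| "graft_list (t # ts) B = graft t B # graft_list ts (\<lambda>j. B (leaves t + j))"

type_synonym 'x forest = "nat \<Rightarrow> 'x tree"

definition strings :: "'x forest" where
  "strings = (\<lambda>i. String)"

text \<open>
  The leaves of \<open>A i\<close> are numbered after those of \<open>A 0, \<dots>, A (i - 1)\<close>.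
\<close>

definition stack :: "'x forest \<Rightarrow> 'x forest \<Rightarrow> 'x forest" (infixr \<open>\<cdot>\<close> 70) where
  "A \<cdot> B = (\<lambda>i. graft (A i) (\<lambda>j. B ((\<Sum>m<i. leaves (A m)) + j)))"

text \<open>
  Below, a \<open>(1,N)\<close>-tangle \<open>X\<close> enters through its number \<open>N\<close> of bottom strings and its label,
  again written \<open>X\<close>.
\<close>

definition shift :: "nat \<Rightarrow> 'x \<Rightarrow> nat \<Rightarrow> 'x forest" where
  "shift N X k = (\<lambda>i. if i = k then Box X (replicate N String) else String)"

definition Alg :: "nat \<Rightarrow> 'x \<Rightarrow> 'x forest set" where
  "Alg N X = {foldr (\<cdot>) (map (shift N X) ks) strings | ks. True}"

definition Alg_tangles :: "nat \<Rightarrow> 'x \<Rightarrow> nat \<Rightarrow> 'x forest set" where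
  "Alg_tangles N X n = {A \<in> Alg N X. (\<forall>i\<ge>1. A i = String) \<and> leaves (A 0) = n}"


section \<open>The group of a singly generated algebra\<close>

definition G_hat :: "nat \<Rightarrow> 'x \<Rightarrow> ('x forest \<times> 'x forest) set" where
  "G_hat N X = {(T, S). \<exists>n. T \<in> Alg_tangles N X n \<and> S \<in> Alg_tangles N X n}"

definition G_step ::
    "nat \<Rightarrow> 'x \<Rightarrow> (('x forest \<times> 'x forest) \<times> ('x forest \<times> 'x forest)) set" where
  "G_step N X = {((T, T'), (S, S')). (T, T') \<in> G_hat N X \<and> (S, S') \<in> G_hat N X \<and>
     (\<exists>R \<in> Alg N X. (T = S \<cdot> R \<and> T' = S' \<cdot> R) \<or> (S = T \<cdot> R \<and> S' = T' \<cdot> R))}"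

definition G_rel ::
    "nat \<Rightarrow> 'x \<Rightarrow> (('x forest \<times> 'x forest) \<times> ('x forest \<times> 'x forest)) set" where
  "G_rel N X = \<Inter>{r. equiv (G_hat N X) r \<and> G_step N X \<subseteq> r}"

text \<open>
  The product is the union of the classes of \<open>(T, R)\<close> over all composable pairs of
  representatives. It is a class exactly when composable representatives exist and the class of
  \<open>(T, R)\<close> does not depend on their choice.
\<close>

definition G_group :: "nat \<Rightarrow> 'x \<Rightarrow> ('x forest \<times> 'x forest) set monoid" where
  "G_group N X =
    \<lparr> carrier = G_hat N X // G_rel N X,
      mult = (\<lambda>g h. \<Union>{G_rel N X `` {(T, R)} | T S R. (T, S) \<in> g \<and> (S, R) \<in> h}),
      one = G_rel N X `` {(strings, strings)} \<rparr>"


section \<open>Groups given by generators and relations\<close>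

text \<open>
  A word is a list of letters; \<open>(a, True)\<close> stands for the generator \<open>a\<close> and \<open>(a, False)\<close> for its
  inverse. A relation \<open>u = v\<close> is the pair \<open>(u, v)\<close> of words.
\<close>

type_synonym 'a word = "('a \<times> bool) list"

definition words :: "'a set \<Rightarrow> 'a word set" where
  "words I = lists (I \<times> UNIV)"

inductive_set pres_rel :: "'a set \<Rightarrow> ('a word \<times> 'a word) set \<Rightarrow> ('a word \<times> 'a word) set"
  for I :: "'a set" and Rels :: "('a word \<times> 'a word) set" where
  refl: "u \<in> words I \<Longrightarrow> (u, u) \<in> pres_rel I Rels"
| sym: "(u, v) \<in> pres_rel I Rels \<Longrightarrow> (v, u) \<in> pres_rel I Rels"
| trans: "(u, v) \<in> pres_rel I Rels \<Longrightarrow> (v, w) \<in> pres_rel I Rels \<Longrightarrow> (u, w) \<in> pres_rel I Rels"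
| append: "(u, v) \<in> pres_rel I Rels \<Longrightarrow> (u', v') \<in> pres_rel I Rels \<Longrightarrow>
    (u @ u', v @ v') \<in> pres_rel I Rels"
| cancel: "a \<in> I \<Longrightarrow> ([(a, b), (a, \<not> b)], []) \<in> pres_rel I Rels"
| rel: "(u, v) \<in> Rels \<Longrightarrow> u \<in> words I \<Longrightarrow> v \<in> words I \<Longrightarrow> (u, v) \<in> pres_rel I Rels"

definition presented_group :: "'a set \<Rightarrow> ('a word \<times> 'a word) set \<Rightarrow> 'a word set monoid" where
  "presented_group I Rels =
    \<lparr> carrier = words I // pres_rel I Rels,
      mult = (\<lambda>a b. \<Union>{pres_rel I Rels `` {u @ v} | u v. u \<in> a \<and> v \<in> b}),
      one = pres_rel I Rels `` {[]} \<rparr>"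

lemma pres_rel_words: "(u, v) \<in> pres_rel I Rels \<Longrightarrow> u \<in> words I \<and> v \<in> words I"
  by (induction rule: pres_rel.induct) (auto simp: words_def)

lemma equiv_pres_rel: "equiv (words I) (pres_rel I Rels)"
proof (rule equivI)
  show "pres_rel I Rels \<subseteq> words I \<times> words I"
    using pres_rel_words by auto
  show "refl_on (words I) (pres_rel I Rels)"
    by (auto intro: refl_onI pres_rel.refl)
  show "sym (pres_rel I Rels)"
    by (auto intro: symI pres_rel.sym)
  show "trans (pres_rel I Rels)"
    by (rule transI) (rule pres_rel.trans)
qed

lemma mult_presented_group:
  assumes "u \<in> words I" "v \<in> words I"
  shows "pres_rel I Rels `` {u} \<otimes>\<^bsub>presented_group I Rels\<^esub> pres_rel I Rels `` {v}
    = pres_rel I Rels `` {u @ v}"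
proof -
  let ?r = "pres_rel I Rels"
  have "?r `` {u' @ v'} = ?r `` {u @ v}" if "(u, u') \<in> ?r" "(v, v') \<in> ?r" for u' v'
    using equiv_class_eq [OF equiv_pres_rel pres_rel.append [OF that]] by simp
  moreover have "(u, u) \<in> ?r" "(v, v) \<in> ?r"
    using assms by (auto intro: pres_rel.refl)
  ultimately have "{?r `` {u' @ v'} | u' v'. u' \<in> ?r `` {u} \<and> v' \<in> ?r `` {v}} = {?r `` {u @ v}}"
    by blast
  then show ?thesis
    by (simp add: presented_group_def)
qed

lemma inverse_word:
  assumes "u \<in> words I"
  shows "\<exists>v \<in> words I. (v @ u, []) \<in> pres_rel I Rels"
  using assms
proof (induction u)
  case Nil
  then show ?case
    by (intro bexI [of _ "[]"]) (auto simp: words_def intro: pres_rel.refl)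
next
  case (Cons p u)
  obtain a b where p: "p = (a, b)" by fastforce
  have a: "a \<in> I" and u: "u \<in> words I"
    using Cons.prems p by (auto simp: words_def)
  obtain v where v: "v \<in> words I" "(v @ u, []) \<in> pres_rel I Rels"
    using Cons.IH [OF u] by blast
  have "([(a, \<not> b), (a, b)], []) \<in> pres_rel I Rels"
    using pres_rel.cancel [OF a, of "\<not> b"] by simp
  then have "([(a, \<not> b), (a, b)] @ u, [] @ u) \<in> pres_rel I Rels"
    by (rule pres_rel.append) (rule pres_rel.refl [OF u])
  then have "(v @ [(a, \<not> b), (a, b)] @ u, v @ [] @ u) \<in> pres_rel I Rels"
    by (rule pres_rel.append [OF pres_rel.refl [OF v(1)]])
  then have "((v @ [(a, \<not> b)]) @ p # u, []) \<in> pres_rel I Rels"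
    using pres_rel.trans v(2) p by fastforce
  moreover have "v @ [(a, \<not> b)] \<in> words I"
    using v(1) a by (auto simp: words_def)
  ultimately show ?case by blast
qed

lemma group_presented_group: "group (presented_group I Rels)"
proof -
  let ?r = "pres_rel I Rels" and ?G = "presented_group I Rels"
  have nil: "[] \<in> words I"
    by (simp add: words_def)
  have app: "u @ v \<in> words I" if "u \<in> words I" "v \<in> words I" for u v
    using that by (auto simp: words_def)
  have one: "\<one>\<^bsub>?G\<^esub> = ?r `` {[]}" and car: "carrier ?G = words I // ?r"
    by (simp_all add: presented_group_def)
  have elim: "\<exists>u \<in> words I. g = ?r `` {u}" if "g \<in> carrier ?G" for g
    using that unfolding car by (auto elim: quotientE)
  have intro: "?r `` {u} \<in> carrier ?G" if "u \<in> words I" for u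
    using that unfolding car by (rule quotientI)
  show ?thesis
  proof (rule groupI)
    fix g h assume "g \<in> carrier ?G" "h \<in> carrier ?G"
    then show "g \<otimes>\<^bsub>?G\<^esub> h \<in> carrier ?G"
      by (metis elim intro app mult_presented_group)
  next
    show "\<one>\<^bsub>?G\<^esub> \<in> carrier ?G"
      using one intro nil by simp
  next
    fix f g h assume "f \<in> carrier ?G" "g \<in> carrier ?G" "h \<in> carrier ?G"
    then obtain u v w where "u \<in> words I" "v \<in> words I" "w \<in> words I"
      "f = ?r `` {u}" "g = ?r `` {v}" "h = ?r `` {w}"
      by (meson elim)
    then show "f \<otimes>\<^bsub>?G\<^esub> g \<otimes>\<^bsub>?G\<^esub> h = f \<otimes>\<^bsub>?G\<^esub> (g \<otimes>\<^bsub>?G\<^esub> h)"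
      by (simp add: mult_presented_group app)
  next
    fix g assume "g \<in> carrier ?G"
    then obtain u where u: "u \<in> words I" "g = ?r `` {u}"
      by (meson elim)
    then show "\<one>\<^bsub>?G\<^esub> \<otimes>\<^bsub>?G\<^esub> g = g"
      by (simp add: one mult_presented_group nil)
    obtain v where v: "v \<in> words I" "(v @ u, []) \<in> ?r"
      using inverse_word [OF u(1)] by blast
    then have "?r `` {v} \<otimes>\<^bsub>?G\<^esub> g = \<one>\<^bsub>?G\<^esub>"
      using u one by (simp add: mult_presented_group equiv_class_eq [OF equiv_pres_rel])
    then show "\<exists>h \<in> carrier ?G. h \<otimes>\<^bsub>?G\<^esub> g = \<one>\<^bsub>?G\<^esub>"
      using intro v(1) by blast
  qed
qed

definition thompson_rels :: "nat \<Rightarrow> (nat word \<times> nat word) set" where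
  "thompson_rels N =
    {([(k, False), (n, True), (k, True)], [(n + N - 1, True)]) | k n. 1 \<le> k \<and> k < n}"

definition thompson_group :: "nat \<Rightarrow> nat word set monoid" where
  "thompson_group N = presented_group {1..} (thompson_rels N)"

end

theory Submission
  imports Complex_Main Defs
begin

text \<open>
  The shifts satisfy \<open>X\<^sub>n \<cdot> X\<^sub>k = X\<^sub>k \<cdot> X\<^bsub>n+N-1\<^esub>\<close> for \<open>k < n\<close>, which are the relations of
  \<open>F\<^sub>N\<close>. Sorting a word in the shifts with these relations gives a normal form for forests, and a
  piecewise linear action of \<open>F\<^sub>N\<close> on the line shows that distinct sorted words stay distinct in
  \<open>F\<^sub>N\<close>. Note that \<open>(T, S) \<mapsto> T S\<^sup>-\<^sup>1\<close> does not reach all of \<open>F\<^sub>N\<close>, because \<open>T\<close> and \<open>S\<close> have equally many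
  boxes. Instead, read a tree as a word in the shifts and drop each letter that grows the
  rightmost leaf, that is, the boxes on the right spine. The resulting \<open>\<delta>(T) \<in> F\<^sub>N\<close> satisfies
  \<open>\<delta>(T \<cdot> R) = \<delta>(T) \<rho>\<close> with \<open>\<rho>\<close> depending only on \<open>R\<close> and the number of leaves of \<open>T\<close>, so
  \<open>[(T, S)] \<mapsto> \<delta>(T) \<delta>(S)\<^sup>-\<^sup>1\<close> is well defined. It is injective because the sorted word of a tree
  can be recovered from the remaining letters and its length. It is surjective because every
  element of \<open>F\<^sub>N\<close> is a quotient of two positive words, and hanging a forest from a long right comb
  turns it into a tree with the same \<open>\<delta>\<close>.
\<close>

section \<open>Preliminaries on grafting and stacking\<close>

lemma strings_stack: "strings \<cdot> B = B"
  by (simp add: stack_def strings_def)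

text \<open>Needed where a box sits above consecutive trees of \<open>A\<close>: grafting through
  the box then agrees with stacking tree by tree.\<close>

lemma graft_list_map_upt:
  "graft_list (map A [a..<b]) (\<lambda>j. B ((\<Sum>m<a. leaves (A m)) + j)) = map (A \<cdot> B) [a..<b]"
proof (induction "b - a" arbitrary: a)
  case (Suc d)
  then have ab: "a < b" by simp
  have "(\<lambda>j. B ((\<Sum>m<a. leaves (A m)) + (leaves (A a) + j))) = (\<lambda>j. B ((\<Sum>m<Suc a. leaves (A m)) + j))"
    by (simp add: add.assoc)
  then show ?case
    using Suc.hyps(1)[of "Suc a"] Suc.hyps(2) ab by (simp add: upt_conv_Cons stack_def)
qed simp

lemma graft_list_replicate_String: "graft_list (replicate n String) B = map B [0..<n]"
  by (induction n arbitrary: B) (simp_all add: upt_conv_Cons map_Suc_upt[symmetric] del: upt_Suc)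

locale caret =
  fixes N :: nat and X :: 'x
  assumes two_le: "2 \<le> N"
begin

section \<open>Forests as words in the shifts\<close>

primrec forest :: "nat list \<Rightarrow> 'x forest" where
  "forest [] = strings"
| "forest (k # ks) = shift N X k \<cdot> forest ks"

lemma forest_eq_foldr: "forest ks = foldr (\<cdot>) (map (shift N X) ks) strings"
  by (induction ks) auto

lemma Alg_eq_range: "Alg N X = range forest"
  by (auto simp: Alg_def forest_eq_foldr)

lemma sum_leaves_shift:
  "(\<Sum>m<i. leaves (shift N X k m)) = (if i \<le> k then i else i + N - 1)"
  using two_le by (induction i) (auto simp: shift_def sum_list_replicate)

lemma shift_stack:
  "(shift N X k \<cdot> B) i =
    (if i < k then B i else if i = k then Box X (map B [k..<k + N]) else B (i + N - 1))"
proof -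
  have "map (\<lambda>j. B (k + j)) [0..<N] = map B [k..<k + N]"
    by (rule nth_equalityI) auto
  then show ?thesis
    unfolding stack_def sum_leaves_shift
    by (auto simp: shift_def graft_list_replicate_String)
qed

text \<open>The box at \<open>k\<close> joins \<open>N\<close> consecutive trees of \<open>B\<close>
  without changing the order of leaves. This supplies the leaf offset in the associativity
  law.\<close>

lemma sum_leaves_shift_stack:
  "(\<Sum>m<i. leaves ((shift N X k \<cdot> B) m)) = (\<Sum>m<(if i \<le> k then i else i + N - 1). leaves (B m))"
proof (induction i)
  case (Suc i)
  consider "i < k" | "i = k" | "k < i" by linarith
  then show ?case
  proof cases
    case 2
    have "(\<Sum>m<k. leaves (B m)) + sum_list (map leaves (map B [k..<k + N])) = (\<Sum>m<k + N. leaves (B m))"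
      by (simp add: interv_sum_list_conv_sum_set_nat o_def)
        (metis atLeast0LessThan le_add1 sum.atLeastLessThan_concat zero_le)
    then show ?thesis using 2 Suc by (simp add: shift_stack)
  next
    case 3
    have "Suc i + N - 1 = Suc (i + N - 1)" using two_le by simp
    then have "(\<Sum>m<Suc i + N - 1. leaves (B m))
        = (\<Sum>m<i + N - 1. leaves (B m)) + leaves (B (i + N - 1))"
      by (metis sum.lessThan_Suc)
    then show ?thesis using 3 Suc by (simp add: shift_stack)
  qed (use Suc in \<open>simp add: shift_stack\<close>)
qed simp

text \<open>Associativity with a single shift in front is enough for words, which are built letter
  by letter.\<close>

lemma shift_stack_assoc: "(shift N X k \<cdot> A) \<cdot> B = shift N X k \<cdot> (A \<cdot> B)"
proof
  fix i
  have *: "((shift N X k \<cdot> A) \<cdot> B) i =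
    graft ((shift N X k \<cdot> A) i) (\<lambda>j. B ((\<Sum>m<(if i \<le> k then i else i + N - 1). leaves (A m)) + j))"
    unfolding stack_def[of "shift N X k \<cdot> A"] sum_leaves_shift_stack ..
  consider "i < k" | "i = k" | "k < i" by linarith
  then show "((shift N X k \<cdot> A) \<cdot> B) i = (shift N X k \<cdot> (A \<cdot> B)) i"
    by cases (unfold *, simp_all add: shift_stack graft_list_map_upt, simp_all add: stack_def)
qed

lemma forest_append: "forest (ks @ ls) = forest ks \<cdot> forest ls"
  by (induction ks) (simp_all add: strings_stack shift_stack_assoc)

text \<open>The two boxes hang from different strings, so either may be drawn first. With the box at
  \<open>k\<close> on top, the string \<open>n\<close> to its right is renumbered by the
  \<open>N - 1\<close> additional strings.\<close>

lemma shift_stack_commute: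
  assumes "k < n"
  shows "shift N X n \<cdot> (shift N X k \<cdot> B) = shift N X k \<cdot> (shift N X (n + N - 1) \<cdot> B)"
proof
  fix i
  have 1: "map (shift N X k \<cdot> B) [n..<n + N] = map B [n + N - 1..<n + N - 1 + N]"
    using two_le assms by (intro nth_equalityI) (auto simp: shift_stack intro: arg_cong[of _ _ B])
  have 2: "map (shift N X (n + N - 1) \<cdot> B) [k..<k + N] = map B [k..<k + N]"
    using two_le assms by (intro map_cong) (auto simp: shift_stack)
  consider "i < k" | "i = k" | "k < i" "i < n" | "i = n" | "n < i" by linarith
  then show "(shift N X n \<cdot> (shift N X k \<cdot> B)) i
      = (shift N X k \<cdot> (shift N X (n + N - 1) \<cdot> B)) i"
    using two_le assms
    by cases (simp_all only: shift_stack[of n "shift N X k \<cdot> B"] shift_stack[of k "shift N X _ \<cdot> B"] 1 2,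
        auto simp: shift_stack)
qed

lemma shift_stack_cancel:
  assumes "shift N X k \<cdot> A = shift N X k \<cdot> B"
  shows "A = B"
proof
  fix i
  note eq = fun_cong[OF assms]
  consider "i < k" | "i \<in> set [k..<k + N]" | "k + N \<le> i" by fastforce
  then show "A i = B i"
  proof cases
    case 2
    have "map A [k..<k + N] = map B [k..<k + N]"
      using eq[of k] by (simp add: shift_stack)
    with 2 show ?thesis by (metis map_eq_conv)
  next
    case 3
    \<comment> \<open>Right of the box, the tree \<open>A i\<close> appears in the product
      \<open>N - 1\<close> places further left.\<close>
    then have "i - (N - 1) + N - 1 = i" "k < i - (N - 1)" using two_le by auto
    then show ?thesis using eq[of "i - (N - 1)"] by (auto simp: shift_stack split: if_splits)
  qed (use eq[of i] in \<open>simp add: shift_stack\<close>)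
qed

text \<open>
  \<open>fits L ks\<close>: starting from \<open>L\<close> leaves, each letter of \<open>ks\<close> is the index of a leaf present at
  that stage.
\<close>

fun fits :: "nat \<Rightarrow> nat list \<Rightarrow> bool" where
  "fits L [] = True"
| "fits L (k # ks) = (k < L \<and> fits (L + N - 1) ks)"

lemma fits_append: "fits L (ks @ ls) \<longleftrightarrow> fits L ks \<and> fits (L + length ks * (N - 1)) ls"
  proof (induction ks arbitrary: L)
  case (Cons k ks)
  have "L + N - 1 + length ks * (N - 1) = L + length (k # ks) * (N - 1)"
    using two_le by simp
  with Cons show ?case by (metis append_Cons fits.simps(2))
qed simp

text \<open>Shows that \<open>fits\<close> depends only on the forest and not on the word chosen for
  it.\<close>

lemma forest_trivial_iff_fits: "(\<forall>i\<ge>L. forest ks i = String) \<longleftrightarrow> fits L ks"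
proof (induction ks arbitrary: L)
  case (Cons k ks)
  let ?B = "forest ks"
  show ?case
  proof (cases "k < L")
    case True
    have "(\<forall>i\<ge>L. (shift N X k \<cdot> ?B) i = String) \<longleftrightarrow> (\<forall>i\<ge>L. ?B (i + N - 1) = String)"
      using True by (auto simp: shift_stack)
    also have "\<dots> \<longleftrightarrow> (\<forall>i\<ge>L + N - 1. ?B i = String)"
    proof (intro iffI allI impI)
      fix i assume *: "\<forall>i\<ge>L. ?B (i + N - 1) = String" and "L + N - 1 \<le> i"
      then have "i - (N - 1) + N - 1 = i" "L \<le> i - (N - 1)" using two_le by auto
      then show "?B i = String" using * by metis
    qed simp
    finally show ?thesis using Cons True by simp
  next
    case False
    then show ?thesis by (auto simp: shift_stack intro!: exI[of _ k])
  qed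
qed (simp add: strings_def)

lemma sum_leaves_forest:
  assumes "fits L ks"
  shows "(\<Sum>m<L. leaves (forest ks m)) = L + length ks * (N - 1)"
  using assms
proof (induction ks arbitrary: L)
  case (Cons k ks)
  then have "(\<Sum>m<L. leaves (forest (k # ks) m)) = L + N - 1 + length ks * (N - 1)"
    by (simp add: sum_leaves_shift_stack)
  then show ?case using two_le by simp
qed (simp add: strings_def)

lemma Alg_tangles_iff:
  "T \<in> Alg_tangles N X n \<longleftrightarrow> (\<exists>ks. fits 1 ks \<and> T = forest ks \<and> n = 1 + length ks * (N - 1))"
proof -
  have leaves: "leaves (forest ks 0) = 1 + length ks * (N - 1)" if "fits 1 ks" for ks
    using sum_leaves_forest[OF that] by simp
  have "T \<in> Alg_tangles N X n \<longleftrightarrow>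
      (\<exists>ks. (\<forall>i\<ge>1. forest ks i = String) \<and> T = forest ks \<and> n = leaves (forest ks 0))"
    unfolding Alg_tangles_def Alg_eq_range by blast
  also have "\<dots> \<longleftrightarrow> (\<exists>ks. fits 1 ks \<and> T = forest ks \<and> n = leaves (forest ks 0))"
    unfolding forest_trivial_iff_fits ..
  also have "\<dots> \<longleftrightarrow> (\<exists>ks. fits 1 ks \<and> T = forest ks \<and> n = 1 + length ks * (N - 1))"
    using leaves by metis
  finally show ?thesis .
qed

section \<open>Normal forms\<close>

text \<open>Insertion step of a sort: each smaller letter that \<open>k\<close> passes on its way to
  the right raises it by \<open>N - 1\<close>, as the commutation of shifts demands.\<close>

fun ins :: "nat \<Rightarrow> nat list \<Rightarrow> nat list" where
  "ins k [] = [k]"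
| "ins k (l # ls) = (if k \<le> l then k # l # ls else l # ins (k + N - 1) ls)"

lemma forest_ins: "forest (ins k ls) = forest (k # ls)"
  by (induction ls arbitrary: k) (simp_all add: shift_stack_commute)

lemma fits_ins: "fits L (ins k ls) \<longleftrightarrow> fits L (k # ls)"
  using two_le by (induction ls arbitrary: k L) auto

lemma set_ins: "b \<le> k \<Longrightarrow> \<forall>l\<in>set ls. b \<le> l \<Longrightarrow> \<forall>l\<in>set (ins k ls). b \<le> l"
proof (induction ls arbitrary: k)
  case (Cons l ls)
  have "b \<le> k + N - 1" using Cons.prems two_le by simp
  then show ?case using Cons.prems Cons.IH[of "k + N - 1"] by simp
qed simp

lemma sorted_ins: "sorted ls \<Longrightarrow> sorted (ins k ls)"
proof (induction ls arbitrary: k)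
  case (Cons l ls)
  then show ?case
    using set_ins[of l "k + N - 1" ls] by auto
qed simp

abbreviation nf :: "nat list \<Rightarrow> nat list" where
  "nf ks \<equiv> foldr ins ks []"

lemma sorted_nf: "sorted (nf ks)"
  by (induction ks) (simp_all add: sorted_ins)

lemma forest_nf: "forest (nf ks) = forest ks"
  by (induction ks) (simp_all add: forest_ins)

lemma fits_nf: "fits L (nf ks) \<longleftrightarrow> fits L ks"
  by (induction ks arbitrary: L) (simp_all add: fits_ins)

lemma length_ins [simp]: "length (ins k ls) = Suc (length ls)"
  by (induction ls arbitrary: k) auto

lemma length_nf: "length (nf ks) = length ks"
  by (induction ks) simp_all

lemma forest_below: "\<forall>k\<in>set ks. i < k \<Longrightarrow> forest ks i = String"
  by (induction ks) (simp_all add: strings_def shift_stack)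

text \<open>The first letter of a sorted word is the position of the leftmost nontrivial tree; it
  can be read off and cancelled.\<close>

lemma forest_inj_sorted: "sorted ks \<Longrightarrow> sorted ls \<Longrightarrow> forest ks = forest ls \<Longrightarrow> ks = ls"
proof (induction ks arbitrary: ls)
  case Nil
  then show ?case
    by (cases ls) (auto simp: strings_def fun_eq_iff shift_stack split: if_splits)
next
  case (Cons k ks)
  then obtain l ls' where ls: "ls = l # ls'"
    by (cases ls) (auto simp: strings_def fun_eq_iff shift_stack split: if_splits)
  have nontrivial: "forest (k # ks) k \<noteq> String" for k ks by (simp add: shift_stack)
  have "\<not> k < l" "\<not> l < k"
    using Cons.prems ls forest_below[of ls k] forest_below[of "k # ks" l]
      nontrivial[of k ks] nontrivial[of l ls'] by force+
  then have "k = l" by simp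
  then show ?case
    using Cons ls shift_stack_cancel by auto
qed

lemma forest_eq_iff_nf: "forest ks = forest ls \<longleftrightarrow> nf ks = nf ls"
  by (metis forest_inj_sorted forest_nf sorted_nf)

section \<open>Common multiples\<close>

text \<open>The letter \<open>a\<close> is pushed through \<open>bs\<close> by the commutation
  relation. It either meets an equal letter and is absorbed, or comes out at the end as
  \<open>d\<close>.\<close>

lemma common_multiple_letter:
  assumes "a < L" "fits L bs"
  shows "\<exists>cs d. fits L (a # cs) \<and> fits L (bs @ d) \<and> length d \<le> 1 \<and> forest (a # cs) = forest (bs @ d)"
  using assms
proof (induction bs arbitrary: a L)
  case Nil
  show ?case
    by (rule exI[of _ "[]"], rule exI[of _ "[a]"]) (use Nil in simp)
next
  case (Cons b bs)
  \<comment> \<open>\<open>a\<close> followed by \<open>e\<close> and \<open>b\<close> followed by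
    \<open>c\<close> give the same forest; then \<open>c\<close> takes the role of \<open>a\<close>
    against the shorter word \<open>bs\<close>.\<close>
  have step: ?case if c: "c < L + N - 1" "forest [a, e] = forest [b, c]" "e < L + N - 1"
    "\<And>zs. forest (a # e # zs) = forest (b # c # zs)" for c e
  proof -
    obtain cs d where "fits (L + N - 1) (c # cs)" "fits (L + N - 1) (bs @ d)" "length d \<le> 1"
      "forest (c # cs) = forest (bs @ d)"
      using Cons.IH[OF c(1)] Cons.prems by auto
    then show ?thesis
      using c Cons.prems by (intro exI[of _ "e # cs"] exI[of _ d]) auto
  qed
  consider "a < b" | "a = b" | "b < a" by linarith
  then show ?case
  proof cases
    case 1
    then show ?thesis using Cons.prems two_le
      by (intro step[of a "b + N - 1"]) (auto simp: shift_stack_commute)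
  next
    case 2
    then show ?thesis using Cons.prems
      by (intro exI[of _ bs] exI[of _ "[]"]) auto
  next
    case 3
    then show ?thesis using Cons.prems two_le
      by (intro step[of "a + N - 1" b]) (auto simp: shift_stack_commute)
  qed
qed

lemma common_multiple:
  assumes "fits L as" "fits L bs"
  obtains cs ds where "fits L (as @ cs)" "fits L (bs @ ds)" "forest (as @ cs) = forest (bs @ ds)"
proof -
  have "\<exists>cs ds. fits L (as @ cs) \<and> fits L (bs @ ds) \<and> forest (as @ cs) = forest (bs @ ds)"
    using assms
  proof (induction as arbitrary: L bs)
    case Nil
    then show ?case by (intro exI[of _ bs] exI[of _ "[]"]) auto
  next
    case (Cons a as)
    obtain cs d where 1: "fits L (a # cs)" "fits L (bs @ d)" "forest (a # cs) = forest (bs @ d)"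
      using common_multiple_letter[of a L bs] Cons.prems by auto
    obtain es fs where 2: "fits (L + N - 1) (as @ es)" "fits (L + N - 1) (cs @ fs)"
      "forest (as @ es) = forest (cs @ fs)"
      using Cons.IH[of "L + N - 1" cs] Cons.prems 1 by auto
    have "forest (bs @ d @ fs) = forest (a # as @ es)"
      using 1(3) 2(3) by (metis append_Cons append_assoc forest_append forest.simps(2))
    moreover have "fits L (bs @ d @ fs)"
    proof -
      \<comment> \<open>Equal forests have equally many boxes, so \<open>fs\<close> meets the same
        number of leaves after either word.\<close>
      have "length (a # cs) = length (bs @ d)"
        using 1(3) by (metis forest_eq_iff_nf length_nf)
      then have "fits L ((bs @ d) @ fs)"
        using 1 2(2) fits_append[of L "a # cs" fs] by (subst fits_append) auto
      then show ?thesis by simp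
    qed
    ultimately show ?case
      using 2 1 Cons.prems by (intro exI[of _ es] exI[of _ "d @ fs"]) auto
  qed
  then show thesis using that by blast
qed

section \<open>Deleting the last leaf\<close>

text \<open>\<open>L\<close> is the current number of leaves, so \<open>L - 1\<close> is the last leaf.\<close>

fun del :: "nat \<Rightarrow> nat list \<Rightarrow> nat list" where
  "del L [] = []"
| "del L (k # ks) = (if Suc k = L then del (L + N - 1) ks else k # del (L + N - 1) ks)"

lemma del_append: "del L (ks @ ls) = del L ks @ del (L + length ks * (N - 1)) ls"
proof (induction ks arbitrary: L)
  case (Cons k ks)
  have "L + N - 1 + length ks * (N - 1) = L + length (k # ks) * (N - 1)"
    using two_le by simp
  with Cons show ?case by (metis append_Cons del.simps(2))
qed simp

lemma del_id: "\<forall>k\<in>set ks. Suc k < L \<Longrightarrow> del L ks = ks"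
proof (induction ks arbitrary: L)
  case (Cons k ks)
  have "L \<le> L + N - 1" using two_le by simp
  with Cons show ?case by (metis del.simps(2) less_le_trans list.set_intros nat_neq_iff)
qed simp

lemma set_del: "set (del L ks) \<subseteq> set ks"
  by (induction ks arbitrary: L) auto

lemma sorted_del: "sorted ks \<Longrightarrow> sorted (del L ks)"
  using set_del by (induction ks arbitrary: L) fastforce+

text \<open>If only one of the two first letters were dropped, it would be \<open>L - 1\<close>, and
  by sortedness every letter left in its word would be at least \<open>L - 1\<close>, while the
  other word keeps a smaller first letter. So both are dropped or both are kept.\<close>

lemma del_inj_sorted:
  "sorted ks \<Longrightarrow> sorted ls \<Longrightarrow> fits L ks \<Longrightarrow> fits L ls \<Longrightarrow> length ks = length ls \<Longrightarrow>
    del L ks = del L ls \<Longrightarrow> ks = ls"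
proof (induction ks arbitrary: ls L)
  case (Cons k ks)
  then obtain l ls' where ls: "ls = l # ls'" by (cases ls) auto
  have ks: "\<forall>x\<in>set (del (L + N - 1) ks). k \<le> x" and ls': "\<forall>x\<in>set (del (L + N - 1) ls'). l \<le> x"
    using Cons.prems ls set_del by fastforce+
  have "k = l \<and> del (L + N - 1) ks = del (L + N - 1) ls'"
  proof -
    have "Suc k = L \<longleftrightarrow> Suc l = L"
      using Cons.prems(3,4,6) ls ks ls'
      by (metis del.simps(2) fits.simps(2) le_antisym less_antisym list.set_intros(1) not_less)
    then show ?thesis using Cons.prems(6) ls by (auto split: if_splits)
  qed
  then show ?case using Cons ls by auto
qed simp

section \<open>Positive elements of the presented group\<close>

abbreviation F where "F \<equiv> thompson_group N"

abbreviation rel where "rel \<equiv> pres_rel {1..} (thompson_rels N)"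

definition cls :: "nat word \<Rightarrow> nat word set" where
  "cls w = rel `` {w}"

lemma cls_eq: "(u, v) \<in> rel \<Longrightarrow> cls u = cls v"
  unfolding cls_def by (rule equiv_class_eq[OF equiv_pres_rel])

text \<open>The shift \<open>X_k\<close> goes to the generator \<open>x_(k+1)\<close>, as the
  presentation counts from 1.\<close>

definition pos :: "nat list \<Rightarrow> nat word set" where
  "pos ks = cls (map (\<lambda>k. (Suc k, True)) ks)"

sublocale F: group F
  unfolding thompson_group_def by (rule group_presented_group)

lemma pos_word: "map (\<lambda>k. (Suc k, True)) ks \<in> words {1..}"
  by (auto simp: words_def)

lemma mult_class:
  "u \<in> words {1..} \<Longrightarrow> v \<in> words {1..} \<Longrightarrow>
    cls u \<otimes>\<^bsub>F\<^esub> cls v = cls (u @ v)"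
  unfolding thompson_group_def cls_def by (rule mult_presented_group)

lemma one_class: "\<one>\<^bsub>F\<^esub> = cls []"
  by (simp add: thompson_group_def presented_group_def cls_def)

lemma class_closed: "u \<in> words {1..} \<Longrightarrow> cls u \<in> carrier F"
  by (simp add: thompson_group_def presented_group_def cls_def quotientI)

lemma pos_closed [simp]: "pos ks \<in> carrier F"
  unfolding pos_def by (rule class_closed [OF pos_word])

lemma pos_append: "pos (ks @ ls) = pos ks \<otimes>\<^bsub>F\<^esub> pos ls"
  by (simp add: pos_def mult_class[OF pos_word pos_word])

lemma pos_Nil: "pos [] = \<one>\<^bsub>F\<^esub>"
  by (simp add: pos_def one_class)

lemma pos_Cons: "pos (k # ks) = pos [k] \<otimes>\<^bsub>F\<^esub> pos ks"
  using pos_append[of "[k]" ks] by simp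

lemma pos_Cons_cong: "pos ks = pos ls \<Longrightarrow> pos (k # ks) = pos (k # ls)"
  by (metis pos_Cons)

lemma inv_letter: "cls [(Suc k, False)] = inv\<^bsub>F\<^esub> pos [k]"
proof -
  have w: "[(Suc k, b)] \<in> words {1..}" for b by (simp add: words_def)
  have "cls [(Suc k, False), (Suc k, True)] = cls []"
    using pres_rel.cancel[of "Suc k" "{1..}" False] by (simp add: cls_eq)
  then have "cls [(Suc k, False)] \<otimes>\<^bsub>F\<^esub> pos [k] = \<one>\<^bsub>F\<^esub>"
    using mult_class[OF w[of False] w[of True]] by (simp add: pos_def one_class)
  then show ?thesis
    using F.inv_equality[OF _ pos_closed class_closed[OF w]] by simp
qed

text \<open>This is the defining conjugation relation multiplied on the left by the letter
  \<open>k\<close>; it mirrors \<open>shift_stack_commute\<close>.\<close>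

lemma pos_commute:
  assumes "k < n"
  shows "pos (n # k # ks) = pos (k # (n + N - 1) # ks)"
proof -
  let ?i = "inv\<^bsub>F\<^esub> pos [k]"
  have "Suc n + N - 1 = Suc (n + N - 1)" using two_le by simp
  then have "([(Suc k, False), (Suc n, True), (Suc k, True)], [(Suc (n + N - 1), True)])
      \<in> thompson_rels N"
    using assms unfolding thompson_rels_def by fastforce
  then have "([(Suc k, False), (Suc n, True), (Suc k, True)], [(Suc (n + N - 1), True)]) \<in> rel"
    by (rule pres_rel.rel) (simp_all add: words_def)
  then have "cls [(Suc k, False), (Suc n, True), (Suc k, True)] = pos [n + N - 1]"
    by (simp add: cls_eq pos_def)
  moreover have "[(Suc k, False)] \<in> words {1..}" by (simp add: words_def)
  ultimately have "?i \<otimes>\<^bsub>F\<^esub> pos [n, k] = pos [n + N - 1]"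
    using mult_class[OF _ pos_word, of "[(Suc k, False)]" "[n, k]"]
    by (simp add: pos_def[of "[n, k]"] inv_letter)
  then have "pos [n, k] = pos [k] \<otimes>\<^bsub>F\<^esub> pos [n + N - 1]"
    by (metis F.inv_solve_left pos_closed)
  then show ?thesis
    using pos_append[of "[n, k]" ks] pos_append[of "[k, n + N - 1]" ks]
      pos_append[of "[k]" "[n + N - 1]"] by simp
qed

lemma pos_ins: "pos (ins k ls) = pos (k # ls)"
proof (induction ls arbitrary: k)
  case (Cons l ls)
  then show ?case
    using pos_Cons_cong[OF Cons.IH[of "k + N - 1"], of l] by (simp add: pos_commute)
qed simp

lemma pos_nf: "pos (nf ks) = pos ks"
proof (induction ks)
  case (Cons k ks)
  then have "pos (k # nf ks) = pos (k # ks)" by (rule pos_Cons_cong)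
  then show ?case by (simp add: pos_ins)
qed simp

lemma pos_cong: "forest ks = forest ls \<Longrightarrow> pos ks = pos ls"
  by (metis forest_eq_iff_nf pos_nf)

text \<open>Sorting is compatible with deletion: passing a smaller letter raises both
  \<open>k\<close> and the number of leaves by \<open>N - 1\<close>, so whether \<open>k\<close> is
  the last leaf does not change. The smaller letter is the last leaf in neither position.\<close>

lemma pos_del_ins: "fits L (k # ls) \<Longrightarrow> pos (del L (ins k ls)) = pos (del L (k # ls))"
proof (induction ls arbitrary: k L)
  case (Cons l ls)
  show ?case
  proof (cases "k \<le> l")
    case False
    let ?d = "del (L + N - 1 + N - 1) ls"
    have *: "Suc l \<noteq> L" "Suc l \<noteq> L + N - 1" "Suc (k + N - 1) = L + N - 1 \<longleftrightarrow> Suc k = L"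
      using False Cons.prems two_le by auto
    have "pos (del L (ins k (l # ls))) = pos (l # del (L + N - 1) (ins (k + N - 1) ls))"
      using False *(1) by simp
    also have "\<dots> = pos (l # del (L + N - 1) ((k + N - 1) # ls))"
      using Cons.prems two_le by (intro pos_Cons_cong Cons.IH) auto
    also have "\<dots> = pos (del L (k # l # ls))"
      using False * pos_commute[of l k ?d] by auto
    finally show ?thesis .
  qed simp
qed simp

lemma pos_del_nf: "fits L ks \<Longrightarrow> pos (del L (nf ks)) = pos (del L ks)"
proof (induction ks arbitrary: L)
  case (Cons k ks)
  have "pos (del L (nf (k # ks))) = pos (del L (k # nf ks))"
    using Cons.prems by (simp add: pos_del_ins fits_nf del: del.simps)
  also have "\<dots> = pos (del L (k # ks))"
    using Cons.prems Cons.IH[of "L + N - 1"] pos_Cons_cong[OF Cons.IH[of "L + N - 1"]] by simp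
  finally show ?case .
qed simp

lemma pos_del_cong: "fits L ks \<Longrightarrow> forest ks = forest ls \<Longrightarrow> pos (del L ks) = pos (del L ls)"
  by (metis fits_nf forest_eq_iff_nf pos_del_nf)

section \<open>Faithfulness on positive words\<close>

text \<open>\<open>pl k\<close> contracts \<open>[k, k + N]\<close> to \<open>[k, k + 1]\<close> and moves everything to the right along.\<close>

definition pl :: "nat \<Rightarrow> real \<Rightarrow> real" where
  "pl k x = (if x \<le> real k then x else if x \<le> real k + real N then real k + (x - real k) / real N else x - (real N - 1))"

definition pl_inv :: "nat \<Rightarrow> real \<Rightarrow> real" where
  "pl_inv k x = (if x \<le> real k then x else if x \<le> real k + 1 then real k + (x - real k) * real N else x + (real N - 1))"

lemma real_two_le: "2 \<le> real N"
  using two_le by simp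

lemma pl_middle:
  assumes "real k < x" "x \<le> real k + real N"
  shows "real k < pl k x" "pl k x \<le> real k + 1"
  using assms real_two_le by (auto simp: pl_def field_simps)

lemma pl_inv_pl: "pl_inv k (pl k x) = x"
proof -
  consider "x \<le> real k" | "real k < x" "x \<le> real k + real N" | "real k + real N < x" by linarith
  then show ?thesis
  proof cases
    case 2
    then show ?thesis using pl_middle[OF 2] real_two_le by (simp add: pl_inv_def) (simp add: pl_def)
  qed (use real_two_le in \<open>auto simp: pl_def pl_inv_def\<close>)
qed

lemma pl_pl_inv: "pl k (pl_inv k x) = x"
proof -
  consider "x \<le> real k" | "real k < x" "x \<le> real k + 1" | "real k + 1 < x" by linarith
  then show ?thesis
  proof cases
    case 2
    define y where "y = (x - real k) * real N"
    have "0 < y" unfolding y_def by (intro mult_pos_pos) (use 2 real_two_le in linarith)+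
    moreover have "y \<le> real N"
      using 2 mult_right_mono[of "x - real k" 1 "real N"] by (simp add: y_def)
    ultimately have "pl k (real k + y) = real k + y / real N" by (simp add: pl_def)
    also have "y / real N = x - real k" using real_two_le by (simp add: y_def)
    finally show ?thesis using 2 by (simp add: pl_inv_def y_def)
  qed (use real_two_le in \<open>auto simp: pl_def pl_inv_def\<close>)
qed

text \<open>Contracting at \<open>k\<close> moves the interval of length \<open>N\<close> at
  \<open>n + N - 1\<close> to \<open>n\<close>, so the two contractions may be carried out in either
  order.\<close>

lemma pl_commute:
  assumes "k < n"
  shows "pl n (pl k x) = pl k (pl (n + N - 1) x)"
proof -
  have n: "real (n + N - 1) = real n + real N - 1" "real k + 1 \<le> real n"
    using assms two_le by auto
  consider "x \<le> real k + real N" | "real k + real N < x" "x \<le> real n + real N - 1" |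
    "real n + real N - 1 < x" "x \<le> real n + real N - 1 + real N" | "real n + real N - 1 + real N < x" by linarith
  then show ?thesis
  proof cases
    case 1
    have "pl k x \<le> real n"
    proof (cases "x \<le> real k")
      case True
      then show ?thesis using n by (simp add: pl_def)
    next
      case False
      then show ?thesis using pl_middle(2)[of k x] 1 n by linarith
    qed
    moreover have "x \<le> real (n + N - 1)" using 1 n by simp
    ultimately show ?thesis by (simp only: pl_def[of n] pl_def[of "n + N - 1"] if_True)
  next
    case 3
    then have x: "pl k x = x - (real N - 1)" using n by (simp add: pl_def)
    have y: "real (n + N - 1) < pl (n + N - 1) x" using pl_middle(1)[of "n + N - 1" x] 3 n by simp
    then have "pl k (pl (n + N - 1) x) = pl (n + N - 1) x - (real N - 1)"
      using n by (simp add: pl_def[of k])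
    then show ?thesis using 3 n by (simp add: x) (simp add: pl_def n algebra_simps)
  qed (use n real_two_le in \<open>auto simp: pl_def\<close>)
qed

text \<open>The generators of the presentation are numbered from \<open>1\<close>, the shifts from \<open>0\<close>.\<close>

primrec act :: "nat word \<Rightarrow> real \<Rightarrow> real" where
  "act [] x = x"
| "act (p # w) x = (if snd p then pl else pl_inv) (fst p - 1) (act w x)"

lemma act_append: "act (u @ v) x = act u (act v x)"
  by (induction u) auto

text \<open>The contractions satisfy the defining relations, so words equal in \<open>F\<close> act
  equally on the line.\<close>

lemma act_rel: "(u, v) \<in> rel \<Longrightarrow> act u x = act v x"
proof (induction arbitrary: x rule: pres_rel.induct)
  case (rel u v)
  then obtain k n where kn: "1 \<le> k" "k < n"
    "u = [(k, False), (n, True), (k, True)]" "v = [(n + N - 1, True)]"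
    by (auto simp: thompson_rels_def)
  then have "n - 1 + N - 1 = n + N - 1 - 1" "k - 1 < n - 1" using two_le by auto
  then have "pl (n - 1) (pl (k - 1) x) = pl (k - 1) (pl (n + N - 1 - 1) x)"
    using pl_commute by metis
  then show ?case by (simp add: kn pl_inv_pl)
next
  case (cancel a b)
  then show ?case by (simp add: pl_inv_pl pl_pl_inv)
qed (auto simp: act_append)

lemma act_pos: "act (map (\<lambda>k. (Suc k, True)) ks) x = foldr pl ks x"
  by (induction ks) auto

lemma foldr_pl_eq: "pos ks = pos ls \<Longrightarrow> foldr pl ks x = foldr pl ls x"
  unfolding pos_def cls_def
  by (drule eq_equiv_class[OF _ equiv_pres_rel pos_word]) (metis act_rel act_pos)

lemma foldr_pl_fixed: "\<forall>k\<in>set ks. x \<le> real k \<Longrightarrow> foldr pl ks x = x"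
  by (induction ks) (auto simp: pl_def)

lemma pl_between:
  assumes "a \<le> k" "real a < x"
  shows "real a < pl k x" "pl k x \<le> x"
proof -
  have "(x - real k) / real N \<le> x - k" if "real k < x"
    using that real_two_le divide_left_mono[of 1 "real N" "x - real k"] by simp
  moreover have "real a < pl k x" if "real k < x" "x \<le> real k + real N"
    using pl_middle(1)[OF that] assms by simp
  ultimately show "real a < pl k x" "pl k x \<le> x"
    using assms real_two_le by (auto simp: pl_def)
qed

lemma foldr_pl_between:
  assumes "\<forall>k\<in>set ks. a \<le> k" "real a < x"
  shows "real a < foldr pl ks x \<and> foldr pl ks x \<le> x"
  using assms by (induction ks) (auto intro: pl_between order_trans[OF pl_between(2)])

text \<open>The point \<open>k + 1\<close> detects the first letter: the later letters keep it in
  the interval from \<open>k\<close> (exclusive) to \<open>k + 1\<close>, and \<open>pl k\<close>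
  shrinks distances from \<open>k\<close> there by the factor \<open>N\<close>. A word with all
  letters above \<open>k\<close> fixes it.\<close>

lemma foldr_pl_moves:
  assumes "sorted (k # ks)"
  shows "foldr pl (k # ks) (real k + 1) < real k + 1"
proof -
  define y where "y = foldr pl ks (real k + 1)"
  have y: "real k < y" "y \<le> real k + 1"
    using foldr_pl_between[of ks k "real k + 1"] assms by (auto simp: y_def)
  then have "(y - real k) / real N < 1" using real_two_le by (simp add: field_simps)
  then show ?thesis using y real_two_le by (simp add: y_def[symmetric]) (simp add: pl_def)
qed

text \<open>The first letter is determined by the action and is cancelled because each
  \<open>pl k\<close> is injective.\<close>

lemma pos_inj_sorted: "sorted ks \<Longrightarrow> sorted ls \<Longrightarrow> pos ks = pos ls \<Longrightarrow> ks = ls"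
proof -
  have less: False
    if "sorted (k # ks)" "\<forall>l\<in>set ls. k < l" "\<forall>x. foldr pl (k # ks) x = foldr pl ls x" for k ks ls
    using foldr_pl_moves[OF that(1)] foldr_pl_fixed[of ls "real k + 1"] that(2,3) by fastforce
  have "sorted ks \<Longrightarrow> sorted ls \<Longrightarrow> \<forall>x. foldr pl ks x = foldr pl ls x \<Longrightarrow> ks = ls"
  proof (induction ks arbitrary: ls)
    case Nil
    then show ?case using less[of "hd ls" "tl ls" "[]"] by (cases ls) auto
  next
    case (Cons k ks)
    then obtain l ls' where ls: "ls = l # ls'"
      using less[of k ks "[]"] by (cases ls) auto
    have "\<not> k < l" "\<not> l < k"
      using less[of k ks ls] less[of l ls' "k # ks"] Cons.prems ls by force+
    then have "k = l" by simp
    moreover from this have "\<forall>x. foldr pl ks x = foldr pl ls' x"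
      using Cons.prems(3) ls pl_inv_pl by (metis foldr_Cons comp_apply)
    ultimately show ?case using Cons ls by auto
  qed
  then show "sorted ks \<Longrightarrow> sorted ls \<Longrightarrow> pos ks = pos ls \<Longrightarrow> ks = ls"
    using foldr_pl_eq by blast
qed

section \<open>Tree pairs\<close>

text \<open>This is \<delta>(T). For a tree the chosen word does not matter, by
  \<open>pos_del_cong\<close>.\<close>

definition elt :: "'x forest \<Rightarrow> nat word set" where
  "elt T = pos (del 1 (SOME ks. fits 1 ks \<and> forest ks = T))"

lemma elt_forest:
  assumes "fits 1 ks"
  shows "elt (forest ks) = pos (del 1 ks)"
proof -
  let ?P = "\<lambda>ls. fits 1 ls \<and> forest ls = forest ks"
  have "?P (SOME ls. ?P ls)" using assms by (intro someI[of ?P ks]) simp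
  then show ?thesis unfolding elt_def by (intro pos_del_cong) auto
qed

lemma elt_closed [simp]: "elt T \<in> carrier F"
  by (simp add: elt_def)

lemma forest_eq_if_elt_eq:
  assumes "fits 1 ks" "fits 1 ls" "length ks = length ls" "elt (forest ks) = elt (forest ls)"
  shows "forest ks = forest ls"
proof -
  have "pos (del 1 (nf ks)) = pos (del 1 (nf ls))"
    using assms by (simp only: elt_forest pos_del_nf)
  then have "del 1 (nf ks) = del 1 (nf ls)"
    by (intro pos_inj_sorted sorted_del sorted_nf)
  then have "nf ks = nf ls"
    by (rule del_inj_sorted[rotated 5]) (simp_all only: assms sorted_nf fits_nf length_nf)
  then show ?thesis by (simp add: forest_eq_iff_nf)
qed

definition ratio :: "'x forest \<times> 'x forest \<Rightarrow> nat word set" where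
  "ratio p = elt (fst p) \<otimes>\<^bsub>F\<^esub> inv\<^bsub>F\<^esub> elt (snd p)"

lemma ratio_closed [simp]: "ratio p \<in> carrier F"
  by (simp add: ratio_def)

lemma G_hat_iff:
  "p \<in> G_hat N X \<longleftrightarrow>
    (\<exists>ks ls. fits 1 ks \<and> fits 1 ls \<and> length ks = length ls \<and> p = (forest ks, forest ls))"
proof -
  have "(T, S) \<in> G_hat N X \<longleftrightarrow>
    (\<exists>ks ls. fits 1 ks \<and> fits 1 ls \<and> length ks = length ls \<and> (T, S) = (forest ks, forest ls))" for T S
  proof -
    \<comment> \<open>Since \<open>N - 1\<close> is nonzero, equally many leaves means equally many
      boxes.\<close>
    have "1 + length ks * (N - 1) = 1 + length ls * (N - 1) \<longleftrightarrow> length ks = length ls"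
      for ks ls :: "nat list"
      using two_le by simp
    then show ?thesis unfolding G_hat_def Alg_tangles_iff by auto metis+
  qed
  then show ?thesis by (cases p) simp
qed

lemma mult_inv_cancel_right:
  assumes "a \<in> carrier F" "b \<in> carrier F" "r \<in> carrier F"
  shows "(a \<otimes>\<^bsub>F\<^esub> r) \<otimes>\<^bsub>F\<^esub> inv\<^bsub>F\<^esub> (b \<otimes>\<^bsub>F\<^esub> r)
    = a \<otimes>\<^bsub>F\<^esub> inv\<^bsub>F\<^esub> b"
proof -
  have "r \<otimes>\<^bsub>F\<^esub> (inv\<^bsub>F\<^esub> r \<otimes>\<^bsub>F\<^esub> inv\<^bsub>F\<^esub> b)
      = inv\<^bsub>F\<^esub> b"
    using assms by (simp add: F.m_assoc[symmetric])
  then show ?thesis using assms by (simp add: F.inv_mult_group F.m_assoc)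
qed

text \<open>Words of equal length reach the same number of leaves, so \<open>rs\<close> contributes
  the same right factor to both, and it cancels in the quotient.\<close>

lemma ratio_append:
  assumes "fits 1 (ks @ rs)" "fits 1 ls" "length ks = length ls"
  shows "fits 1 (ls @ rs)" "ratio (forest (ks @ rs), forest (ls @ rs)) = ratio (forest ks, forest ls)"
proof -
  show f: "fits 1 (ls @ rs)" using assms by (simp add: fits_append)
  have "fits 1 ks" using assms by (simp add: fits_append)
  then show "ratio (forest (ks @ rs), forest (ls @ rs)) = ratio (forest ks, forest ls)"
    using assms f
    by (simp only: ratio_def fst_conv snd_conv elt_forest del_append pos_append)
      (simp add: mult_inv_cancel_right)
qed

section \<open>The generated equivalence as the fibres of \<open>ratio\<close>\<close>

lemma ratio_G_step:
  assumes "(p, q) \<in> G_step N X"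
  shows "ratio p = ratio q"
proof -
  have *: "ratio (S \<cdot> R, S' \<cdot> R) = ratio (S, S')"
    if hat: "(S \<cdot> R, S' \<cdot> R) \<in> G_hat N X" "(S, S') \<in> G_hat N X" and R: "R \<in> Alg N X" for S S' R
  proof -
    obtain rs where rs: "R = forest rs" using R by (auto simp: Alg_eq_range)
    obtain ks ls where ks: "fits 1 ks" "fits 1 ls" "length ks = length ls" "S = forest ks" "S' = forest ls"
      using hat by (auto simp: G_hat_iff)
    \<comment> \<open>Some fitting word represents the stacked tree; fitting depends only on the
      forest, so it carries over to \<open>ks @ rs\<close>.\<close>
    obtain ts where "fits 1 ts" "forest (ks @ rs) = forest ts"
      using hat rs ks by (auto simp: G_hat_iff forest_append)
    then have "fits 1 (ks @ rs)" by (metis forest_eq_iff_nf fits_nf)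
    then show ?thesis
      using ratio_append(2)[of ks rs ls] ks rs by (simp add: forest_append)
  qed
  show ?thesis
    using assms unfolding G_step_def by (auto simp: * )
qed

lemma G_step_append:
  assumes "fits 1 (ks @ rs)" "fits 1 ls" "length ks = length ls"
  shows "((forest ks, forest ls), (forest (ks @ rs), forest (ls @ rs))) \<in> G_step N X"
proof -
  have "fits 1 (ls @ rs)" "fits 1 ks" using assms by (simp_all add: fits_append)
  moreover have "forest (ks @ rs) = forest ks \<cdot> forest rs" "forest (ls @ rs) = forest ls \<cdot> forest rs"
    "forest rs \<in> Alg N X"
    by (simp_all add: forest_append Alg_eq_range)
  moreover have "(forest ks, forest ls) \<in> G_hat N X" "(forest (ks @ rs), forest (ls @ rs)) \<in> G_hat N X"
    using assms calculation by (auto simp: G_hat_iff simp del: fits_append) (metis length_append)+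
  ultimately show ?thesis unfolding G_step_def by auto
qed

text \<open>Forwards, the fibres of \<open>ratio\<close> form an equivalence containing all steps.
  Backwards, two pairs are expanded until their first trees agree; equal ratios then force the
  second trees to agree, so the pairs have a common expansion.\<close>

lemma G_rel_iff: "(p, q) \<in> G_rel N X \<longleftrightarrow> p \<in> G_hat N X \<and> q \<in> G_hat N X \<and> ratio p = ratio q"
proof
  let ?r = "{(p, q). p \<in> G_hat N X \<and> q \<in> G_hat N X \<and> ratio p = ratio q}"
  have "equiv (G_hat N X) ?r"
    by (auto intro!: equivI refl_onI symI transI)
  moreover have "G_step N X \<subseteq> ?r"
  proof (rule subrelI)
    fix p q assume pq: "(p, q) \<in> G_step N X"
    then have "p \<in> G_hat N X" "q \<in> G_hat N X" by (auto simp: G_step_def)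
    with ratio_G_step[OF pq] show "(p, q) \<in> ?r" by simp
  qed
  moreover assume "(p, q) \<in> G_rel N X"
  ultimately show "p \<in> G_hat N X \<and> q \<in> G_hat N X \<and> ratio p = ratio q"
    unfolding G_rel_def by blast
next
  assume *: "p \<in> G_hat N X \<and> q \<in> G_hat N X \<and> ratio p = ratio q"
  obtain a b where p: "fits 1 a" "fits 1 b" "length a = length b" "p = (forest a, forest b)"
    using * by (auto simp: G_hat_iff)
  obtain a' b' where q: "fits 1 a'" "fits 1 b'" "length a' = length b'" "q = (forest a', forest b')"
    using * by (auto simp: G_hat_iff)
  obtain c d where cd: "fits 1 (a @ c)" "fits 1 (a' @ d)" "forest (a @ c) = forest (a' @ d)"
    using common_multiple[OF p(1) q(1)] by blast
  note c = ratio_append[OF cd(1) p(2,3)] and d = ratio_append[OF cd(2) q(2,3)]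
  have "elt (forest (a @ c)) \<otimes>\<^bsub>F\<^esub> inv\<^bsub>F\<^esub> elt (forest (b @ c))
      = elt (forest (a @ c)) \<otimes>\<^bsub>F\<^esub> inv\<^bsub>F\<^esub> elt (forest (b' @ d))"
    using * c(2) d(2) p(4) q(4) cd(3) by (simp add: ratio_def)
  then have "elt (forest (b @ c)) = elt (forest (b' @ d))"
    by (metis F.inv_closed F.inv_inv F.Units_eq F.Units_l_cancel elt_closed)
  moreover have "length (b @ c) = length (b' @ d)"
    using cd(3) p(3) q(3) by (metis forest_eq_iff_nf length_append length_nf)
  ultimately have "forest (b @ c) = forest (b' @ d)"
    using c(1) d(1) by (intro forest_eq_if_elt_eq) auto
  then have "(p, (forest (a @ c), forest (b @ c))) \<in> G_step N X"
    "(q, (forest (a @ c), forest (b @ c))) \<in> G_step N X"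
    using G_step_append[OF cd(1) p(2,3)] G_step_append[OF cd(2) q(2,3)] p(4) q(4) cd(3) by auto
  then have "(p, q) \<in> r" if "equiv (G_hat N X) r" "G_step N X \<subseteq> r" for r
    using that by (meson equivE subsetD symD transD)
  then show "(p, q) \<in> G_rel N X" unfolding G_rel_def by blast
qed

lemma equiv_G_rel: "equiv (G_hat N X) (G_rel N X)"
  by (auto intro!: equivI refl_onI symI transI simp: G_rel_iff)

text \<open>A common multiple of the second tree of \<open>p\<close> and the first tree of
  \<open>q\<close> provides composable representatives. Any composable choice has the product of the
  ratios as its ratio, so the union in the definition is over one single class.\<close>

lemma mult_G_group:
  assumes p: "p \<in> G_hat N X" and q: "q \<in> G_hat N X"
  obtains r where "r \<in> G_hat N X" "ratio r = ratio p \<otimes>\<^bsub>F\<^esub> ratio q"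
    "G_rel N X `` {p} \<otimes>\<^bsub>G_group N X\<^esub> G_rel N X `` {q} = G_rel N X `` {r}"
proof -
  have comp: "(T, R) \<in> G_hat N X" "ratio (T, R) = ratio (T, S) \<otimes>\<^bsub>F\<^esub> ratio (S, R)"
    if "(T, S) \<in> G_hat N X" "(S, R) \<in> G_hat N X" for T S R
  proof -
    show "(T, R) \<in> G_hat N X" using that by (auto simp: G_hat_def Alg_tangles_def)
    have "inv\<^bsub>F\<^esub> elt S \<otimes>\<^bsub>F\<^esub> (elt S \<otimes>\<^bsub>F\<^esub> inv\<^bsub>F\<^esub> elt R)
        = inv\<^bsub>F\<^esub> elt R"
      by (simp add: F.m_assoc[symmetric])
    then show "ratio (T, R) = ratio (T, S) \<otimes>\<^bsub>F\<^esub> ratio (S, R)"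
      by (simp add: ratio_def F.m_assoc)
  qed
  obtain a b where p': "fits 1 a" "fits 1 b" "length a = length b" "p = (forest a, forest b)"
    using p by (auto simp: G_hat_iff)
  obtain a' b' where q': "fits 1 a'" "fits 1 b'" "length a' = length b'" "q = (forest a', forest b')"
    using q by (auto simp: G_hat_iff)
  obtain c d where cd: "fits 1 (b @ c)" "fits 1 (a' @ d)" "forest (b @ c) = forest (a' @ d)"
    using common_multiple[OF p'(2) q'(1)] by blast
  have ac: "fits 1 (a @ c)" using ratio_append(1)[OF cd(1) p'(1)] p'(3) by simp
  let ?T = "forest (a @ c)" and ?S = "forest (b @ c)" and ?R = "forest (b' @ d)"
  have TS: "(p, (?T, ?S)) \<in> G_rel N X"
    using p ratio_append[OF ac p'(2,3)] ac p'(3,4) by (auto simp: G_rel_iff G_hat_iff) (metis length_append)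
  have SR: "(q, (?S, ?R)) \<in> G_rel N X"
    using q ratio_append[OF cd(2) q'(2,3)] cd(2,3) q'(3,4) by (auto simp: G_rel_iff G_hat_iff) (metis length_append)
  have r: "(?T, ?R) \<in> G_hat N X" "ratio (?T, ?R) = ratio p \<otimes>\<^bsub>F\<^esub> ratio q"
    using comp[of ?T ?S ?R] TS SR by (auto simp: G_rel_iff)
  have "G_rel N X `` {(T, R)} = G_rel N X `` {(?T, ?R)}"
    if "(T, S) \<in> G_rel N X `` {p}" "(S, R) \<in> G_rel N X `` {q}" for T S R
    using that comp[of T S R] r by (intro equiv_class_eq[OF equiv_G_rel]) (auto simp: G_rel_iff)
  then have "{G_rel N X `` {(T, R)} | T S R. (T, S) \<in> G_rel N X `` {p} \<and> (S, R) \<in> G_rel N X `` {q}}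
      = {G_rel N X `` {(?T, ?R)}}"
    using TS SR by blast
  then have "G_rel N X `` {p} \<otimes>\<^bsub>G_group N X\<^esub> G_rel N X `` {q} = G_rel N X `` {(?T, ?R)}"
    by (simp add: G_group_def)
  with r show thesis using that by blast
qed

section \<open>Surjectivity\<close>

text \<open>The letters that extend the right spine \<open>m\<close> times, starting from \<open>L > 0\<close> leaves.\<close>

fun comb :: "nat \<Rightarrow> nat \<Rightarrow> nat list" where
  "comb L 0 = []"
| "comb L (Suc m) = (L - 1) # comb (L + N - 1) m"

lemma fits_comb: "0 < L \<Longrightarrow> fits L (comb L m)"
  using two_le by (induction m arbitrary: L) auto

lemma del_comb: "0 < L \<Longrightarrow> del L (comb L m) = []"
  using two_le by (induction m arbitrary: L) auto

lemma length_comb [simp]: "length (comb L m) = m"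
  by (induction m arbitrary: L) auto

lemma fits_if_bounded: "\<forall>k\<in>set ks. k < L \<Longrightarrow> fits L ks"
proof (induction ks arbitrary: L)
  case (Cons k ks)
  have "\<forall>x\<in>set ks. x < L + N - 1" using Cons.prems two_le by fastforce
  then show ?case using Cons by simp
qed simp

text \<open>A comb of \<open>m\<close> boxes has more than \<open>m\<close> leaves, so letters below
  \<open>m\<close> never hit the last leaf, and deletion removes exactly the comb.\<close>

lemma comb_append:
  assumes "\<forall>k\<in>set ks. k < m"
  shows "fits 1 (comb 1 m @ ks)" "del 1 (comb 1 m @ ks) = ks"
proof -
  have *: "Suc k < 1 + m * (N - 1)" if "k \<in> set ks" for k
  proof -
    have "k < m" using assms that by blast
    also have "m \<le> m * (N - 1)" using two_le by (cases "N - 1") auto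
    finally show ?thesis by simp
  qed
  have "fits (1 + m * (N - 1)) ks" using Suc_lessD[OF *] by (intro fits_if_bounded ballI)
  then show "fits 1 (comb 1 m @ ks)"
    unfolding fits_append length_comb by (simp add: fits_comb)
  have "del (1 + m * (N - 1)) ks = ks" by (intro del_id ballI *)
  then show "del 1 (comb 1 m @ ks) = ks"
    unfolding del_append length_comb by (simp add: del_comb)
qed

text \<open>A common multiple of \<open>as\<close> and \<open>bs\<close> moves the inverse from the
  left to the right.\<close>

lemma positive_fraction_inv:
  "\<exists>cs ds. inv\<^bsub>F\<^esub> pos as \<otimes>\<^bsub>F\<^esub> pos bs
    = pos cs \<otimes>\<^bsub>F\<^esub> inv\<^bsub>F\<^esub> pos ds"
proof -
  obtain L where "\<forall>k\<in>set as \<union> set bs. k < L"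
    by (meson finite_UnI finite_nat_set_iff_bounded finite_set)
  then have "fits L as" "fits L bs" by (auto intro!: fits_if_bounded)
  then obtain cs ds where "forest (as @ cs) = forest (bs @ ds)"
    using common_multiple by metis
  then have "pos as \<otimes>\<^bsub>F\<^esub> pos cs = pos bs \<otimes>\<^bsub>F\<^esub> pos ds"
    using pos_cong by (metis pos_append)
  then have "pos cs = (inv\<^bsub>F\<^esub> pos as \<otimes>\<^bsub>F\<^esub> pos bs) \<otimes>\<^bsub>F\<^esub> pos ds"
    by (simp add: F.m_assoc F.inv_solve_left)
  then show ?thesis
    by (metis F.inv_closed F.inv_solve_right F.m_closed pos_closed)
qed

lemma positive_fraction:
  assumes "w \<in> words {1..}"
  shows "\<exists>as bs. cls w = pos as \<otimes>\<^bsub>F\<^esub> inv\<^bsub>F\<^esub> pos bs"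
  using assms
proof (induction w)
  case Nil
  then show ?case
    by (intro exI[of _ "[]"]) (simp add: pos_Nil one_class[symmetric])
next
  case (Cons p w)
  obtain k b where p: "p = (Suc k, b)"
    using Cons.prems by (cases p; cases "fst p") (auto simp: words_def)
  have w: "w \<in> words {1..}" "[p] \<in> words {1..}" using Cons.prems by (auto simp: words_def)
  obtain as bs where ih: "cls w = pos as \<otimes>\<^bsub>F\<^esub> inv\<^bsub>F\<^esub> pos bs"
    using Cons.IH[OF w(1)] by blast
  have cons: "cls (p # w) = cls [p] \<otimes>\<^bsub>F\<^esub> cls w"
    using mult_class[OF w(2,1)] by simp
  show ?case
  proof (cases b)
    case True
    then have "cls (p # w) = pos (k # as) \<otimes>\<^bsub>F\<^esub> inv\<^bsub>F\<^esub> pos bs"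
      using cons ih by (simp add: p pos_Cons[of k as] F.m_assoc) (simp add: pos_def)
    then show ?thesis by blast
  next
    case False
    obtain cs ds where "inv\<^bsub>F\<^esub> pos [k] \<otimes>\<^bsub>F\<^esub> pos as
        = pos cs \<otimes>\<^bsub>F\<^esub> inv\<^bsub>F\<^esub> pos ds"
      using positive_fraction_inv by blast
    then have "cls (p # w)
        = pos cs \<otimes>\<^bsub>F\<^esub> inv\<^bsub>F\<^esub> pos (bs @ ds)"
      using False cons ih
      by (simp add: p inv_letter F.m_assoc[symmetric])
        (simp add: pos_append F.m_assoc F.inv_mult_group)
    then show ?thesis by blast
  qed
qed

lemma ratio_surj:
  assumes "g \<in> carrier F"
  obtains p where "p \<in> G_hat N X" "ratio p = g"
proof -
  obtain w where "w \<in> words {1..}" "g = cls w"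
    using assms by (auto simp: thompson_group_def presented_group_def cls_def elim: quotientE)
  then obtain as bs where g: "g = pos as \<otimes>\<^bsub>F\<^esub> inv\<^bsub>F\<^esub> pos bs"
    using positive_fraction by blast
  obtain M where M: "\<forall>k\<in>set as \<union> set bs. k < M"
    by (meson finite_UnI finite_nat_set_iff_bounded finite_set)
  \<comment> \<open>Each comb is lengthened by the length of the other word, which makes
    \<open>u\<close> and \<open>v\<close> equally long, as a tree pair requires.\<close>
  define u where "u = comb 1 (M + length bs) @ as"
  define v where "v = comb 1 (M + length as) @ bs"
  have "\<forall>k\<in>set as. k < M + length bs" "\<forall>k\<in>set bs. k < M + length as"
    using M by (simp_all add: trans_less_add1)
  note u = comb_append[OF this(1), folded u_def] and v = comb_append[OF this(2), folded v_def]
  have "length u = length v" by (simp add: u_def v_def)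
  with u v have "(forest u, forest v) \<in> G_hat N X" by (auto simp: G_hat_iff)
  moreover have "ratio (forest u, forest v) = g"
    using u v by (simp only: ratio_def fst_conv snd_conv elt_forest g)
  ultimately show thesis using that by blast
qed

section \<open>The isomorphism\<close>

text \<open>Inverse of the map induced by \<open>ratio\<close>: the classes are exactly its
  fibres.\<close>

definition to_G :: "nat word set \<Rightarrow> ('x forest \<times> 'x forest) set" where
  "to_G g = {p \<in> G_hat N X. ratio p = g}"

lemma to_G_ratio: "p \<in> G_hat N X \<Longrightarrow> to_G (ratio p) = G_rel N X `` {p}"
  by (auto simp: to_G_def G_rel_iff)

lemma to_G_cases:
  assumes "g \<in> carrier F"
  obtains p where "p \<in> G_hat N X" "ratio p = g" "to_G g = G_rel N X `` {p}"
  using ratio_surj[OF assms] to_G_ratio by metis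

lemma to_G_hom: "to_G \<in> hom F (G_group N X)"
proof (rule homI)
  fix g assume "g \<in> carrier F"
  then obtain p where "p \<in> G_hat N X" "to_G g = G_rel N X `` {p}"
    by (rule to_G_cases)
  then show "to_G g \<in> carrier (G_group N X)"
    by (simp add: G_group_def quotientI)
next
  fix g h assume "g \<in> carrier F" "h \<in> carrier F"
  then obtain p q where p: "p \<in> G_hat N X" "ratio p = g" "to_G g = G_rel N X `` {p}"
    and q: "q \<in> G_hat N X" "ratio q = h" "to_G h = G_rel N X `` {q}"
    by (metis to_G_cases)
  obtain r where r: "r \<in> G_hat N X" "ratio r = g \<otimes>\<^bsub>F\<^esub> h"
    "to_G g \<otimes>\<^bsub>G_group N X\<^esub> to_G h = G_rel N X `` {r}"
    using mult_G_group[OF p(1) q(1)] p q by metis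
  then show "to_G (g \<otimes>\<^bsub>F\<^esub> h) = to_G g \<otimes>\<^bsub>G_group N X\<^esub> to_G h"
    using to_G_ratio[OF r(1)] by simp
qed

lemma bij_to_G: "bij_betw to_G (carrier F) (carrier (G_group N X))"
proof (rule bij_betwI')
  fix g h assume "g \<in> carrier F" "h \<in> carrier F"
  then obtain p where "p \<in> G_hat N X" "ratio p = g"
    by (metis ratio_surj)
  then show "to_G g = to_G h \<longleftrightarrow> g = h" by (auto simp: to_G_def)
next
  fix g assume "g \<in> carrier F"
  then show "to_G g \<in> carrier (G_group N X)" by (rule hom_in_carrier[OF to_G_hom])
next
  fix c assume "c \<in> carrier (G_group N X)"
  then obtain p where "p \<in> G_hat N X" "c = G_rel N X `` {p}"
    by (auto simp: G_group_def elim: quotientE)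
  then show "\<exists>g\<in>carrier F. c = to_G g"
    using to_G_ratio ratio_closed by metis
qed

lemma to_G_one: "to_G \<one>\<^bsub>F\<^esub> = \<one>\<^bsub>G_group N X\<^esub>"
proof -
  have "(strings, strings) \<in> G_hat N X"
    unfolding G_hat_iff by (intro exI[of _ "[]"]) simp
  moreover have "ratio (strings, strings) = \<one>\<^bsub>F\<^esub>"
    by (simp add: ratio_def)
  ultimately show ?thesis
    using to_G_ratio[of "(strings, strings)"] by (simp add: G_group_def)
qed

text \<open>The group axioms are transported from \<open>F\<close> along the bijective homomorphism
  \<open>to_G\<close>; \<open>to_G_one\<close> matches the units.\<close>

lemma group_G_group: "group (G_group N X)"
  using F.hom_imp_img_group[OF to_G_hom] bij_betw_imp_surj_on[OF bij_to_G] to_G_one by simp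

lemma G_group_iso: "G_group N X \<cong> thompson_group N"
proof -
  have "to_G \<in> iso F (G_group N X)"
    using to_G_hom bij_to_G by (simp add: iso_def)
  then show ?thesis by (meson F.iso_sym is_isoI)
qed

end

theorem theorem1p2:
  fixes N :: nat and X :: 'x
  assumes "N \<ge> 2"
  shows "group (G_group N X) \<and> G_group N X \<cong> thompson_group N"
proof -
  interpret caret N X by unfold_locales (rule assms)
  show ?thesis using group_G_group G_group_iso by blast
qed

end
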